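(* Let $n$ be an even positive integer and $k$ an integer with $2\leq k\leq \frac{n}{2}-1$, and let $G$ be a connected balanced bipartite graph of order $n$. If $$\rho(G)\geq \rho\bigl(K_{\frac{n}{2},\frac{n}{2}}\backslash E(K_{1,\frac{n}{2}-k+1})\bigr),$$ then $G$ contains a $k$-factor, unless $G\cong K_{\frac{n}{2},\frac{n}{2}}\backslash E(K_{1,\frac{n}{2}-k+1})$.
   Context: All graphs are finite, simple and undirected. For a graph $G$, $\rho(G)$ denotes the spectral radius, i.e. the largest eigenvalue of its adjacency matrix. A bipartite graph with bipartition $(X,Y)$ is balanced if $|X|=|Y|$. A $k$-factor of $G$ is a $k$-regular spanning subgraph of $G$. $K_{p,q}$ is the complete bipartite graph with parts of sizes $p$ and $q$. For a subgraph $H$ of $G$, $G\backslash E(H)$ is the graph obtained from $G$ by deleting the edges of $H$ (keeping all vertices); thus $K_{\frac{n}{2},\frac{n}{2}}\backslash E(K_{1,\frac{n}{2}-k+1})$ is obtained from $K_{\frac n2,\frac n2}$ by deleting $\frac n2-k+1$ edges incident with one fixed vertex. *)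

theory Defs
  imports "Graph_Theory.Graph_Theory" "Jordan_Normal_Form.Char_Poly"
begin

text \<open>
  Finite simple undirected graphs are the symmetric loop-free pair digraphs \<^const>\<open>pair_graph\<close>:
  an edge $uv$ is the pair of arcs $(u,v)$, $(v,u)$. Hence the degree of a vertex is its
  \<^const>\<open>out_degree\<close>, and graph isomorphism is \<^const>\<open>digraph_iso\<close>.
\<close>

definition adjacency_mat :: "'a pair_pre_digraph \<Rightarrow> 'a list \<Rightarrow> real mat" where
  "adjacency_mat G vs =
     mat (length vs) (length vs) (\<lambda>(i, j). if (vs ! i, vs ! j) \<in> parcs G then 1 else 0)"

text \<open>
  The choice of the vertex enumeration is immaterial, see \<open>eigenvalue_adjacency_mat_cong\<close> below.
\<close>

definition graph_spectral_radius :: "'a pair_pre_digraph \<Rightarrow> real" where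
  "graph_spectral_radius G =
     Max {x. eigenvalue (adjacency_mat G (SOME vs. distinct vs \<and> set vs = pverts G)) x}"

definition bipartition :: "'a pair_pre_digraph \<Rightarrow> 'a set \<Rightarrow> 'a set \<Rightarrow> bool" where
  "bipartition G X Y \<longleftrightarrow>
     X \<union> Y = pverts G \<and> X \<inter> Y = {} \<and> parcs G \<subseteq> X \<times> Y \<union> Y \<times> X"

definition balanced_bipartite :: "'a pair_pre_digraph \<Rightarrow> bool" where
  "balanced_bipartite G \<longleftrightarrow> (\<exists>X Y. bipartition G X Y \<and> card X = card Y)"

definition k_factor :: "nat \<Rightarrow> 'a pair_pre_digraph \<Rightarrow> 'a pair_pre_digraph \<Rightarrow> bool" where
  "k_factor k H G \<longleftrightarrow>
     pair_graph H \<and> spanning (with_proj H) (with_proj G) \<and>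
     (\<forall>v \<in> pverts H. out_degree (with_proj H) v = k)"

definition complete_bipartite :: "nat \<Rightarrow> nat \<Rightarrow> (nat + nat) pair_pre_digraph" where
  "complete_bipartite p q =
     (let X = Inl ` {..<p}; Y = Inr ` {..<q}
      in \<lparr> pverts = X \<union> Y, parcs = X \<times> Y \<union> Y \<times> X \<rparr>)"

definition delete_edges :: "'a pair_pre_digraph \<Rightarrow> 'a pair_pre_digraph \<Rightarrow> 'a pair_pre_digraph" where
  "delete_edges G H = \<lparr> pverts = pverts G, parcs = parcs G - parcs H \<rparr>"

text \<open>
  \<^term>\<open>complete_bipartite 1 r\<close> is literally a subgraph of \<^term>\<open>complete_bipartite m m\<close> for
  \<open>1 \<le> m\<close> and \<open>r \<le> m\<close>, so the following deletes \<open>m - k + 1\<close> edges at the vertex \<^term>\<open>Inl 0\<close>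
  (for \<open>1 \<le> k \<le> m\<close>).
\<close>

definition extremal_graph :: "nat \<Rightarrow> nat \<Rightarrow> (nat + nat) pair_pre_digraph" where
  "extremal_graph m k = delete_edges (complete_bipartite m m) (complete_bipartite 1 (m - k + 1))"

lemma complete_bipartite_digraph_complete_bipartite:
  "complete_bipartite_digraph p q (with_proj (complete_bipartite p q))"
proof -
  let ?X = "Inl ` {..<p} :: (nat + nat) set" and ?Y = "Inr ` {..<q} :: (nat + nat) set"
  have "card ?X = p" "card ?Y = q" "?X \<inter> ?Y = {}"
    by (auto simp: card_image)
  then show ?thesis
    unfolding complete_bipartite_digraph_pair_def complete_bipartite_def Let_def
    by (intro conjI exI[of _ ?X] exI[of _ ?Y]) auto
qed

lemma subgraph_star_complete_bipartite:
  assumes "1 \<le> m" "r \<le> m"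
  shows "subgraph (with_proj (complete_bipartite 1 r)) (with_proj (complete_bipartite m m))"
proof -
  interpret A: pair_graph "complete_bipartite 1 r"
    by (rule pair_graphI_complete_bipartite) (rule complete_bipartite_digraph_complete_bipartite)
  interpret B: pair_graph "complete_bipartite m m"
    by (rule pair_graphI_complete_bipartite) (rule complete_bipartite_digraph_complete_bipartite)
  have "pverts (complete_bipartite 1 r) \<subseteq> pverts (complete_bipartite m m)"
    "parcs (complete_bipartite 1 r) \<subseteq> parcs (complete_bipartite m m)"
    using assms by (auto simp: complete_bipartite_def)
  then show ?thesis
    using A.wf_digraph B.wf_digraph by (simp add: subgraph_def compatible_def)
qed

lemma eigenvalue_adjacency_mat_iff:
  assumes "distinct vs"
  shows "eigenvalue (adjacency_mat G vs) x \<longleftrightarrow>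
    (\<exists>f. (\<exists>v \<in> set vs. f v \<noteq> 0) \<and>
         (\<forall>v \<in> set vs. (\<Sum>u \<in> set vs. (if (v, u) \<in> parcs G then f u else 0)) = x * f v))"
    (is "?L \<longleftrightarrow> ?R")
proof -
  let ?n = "length vs"
  have bij: "bij_betw ((!) vs) {0..<?n} (set vs)"
    using assms by (auto simp: bij_betw_def inj_on_nth set_conv_nth)
  have sum_vs: "(\<Sum>u \<in> set vs. g u) = (\<Sum>j = 0..<?n. g (vs ! j))" for g :: "'a \<Rightarrow> real"
    using sum.reindex_bij_betw[OF bij, of g] by simp
  have row: "(adjacency_mat G vs *\<^sub>v w) $ i =
      (\<Sum>j = 0..<?n. if (vs ! i, vs ! j) \<in> parcs G then w $ j else 0)"
    if "i < ?n" "w \<in> carrier_vec ?n" for i w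
    using that by (auto simp: adjacency_mat_def scalar_prod_def intro!: sum.cong)
  show ?thesis
  proof
    assume ?L
    then obtain w where w: "w \<in> carrier_vec ?n" "w \<noteq> 0\<^sub>v ?n"
        "adjacency_mat G vs *\<^sub>v w = x \<cdot>\<^sub>v w"
      unfolding eigenvalue_def eigenvector_def by (auto simp: adjacency_mat_def)
    define f where "f v = w $ (the_inv_into {0..<?n} ((!) vs) v)" for v
    have f: "f (vs ! i) = w $ i" if "i < ?n" for i
      using that bij by (simp add: f_def the_inv_into_f_f bij_betw_def)
    have "\<exists>i < ?n. w $ i \<noteq> 0"
      using w(1,2) by (auto simp: vec_eq_iff)
    then have "\<exists>v \<in> set vs. f v \<noteq> 0"
      using f by (metis nth_mem)
    moreover have "(\<Sum>u \<in> set vs. (if (v, u) \<in> parcs G then f u else 0)) = x * f v"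
      if "v \<in> set vs" for v
    proof -
      from that obtain i where i: "i < ?n" "v = vs ! i"
        by (auto simp: in_set_conv_nth)
      have "(\<Sum>u \<in> set vs. (if (v, u) \<in> parcs G then f u else 0)) =
          (adjacency_mat G vs *\<^sub>v w) $ i"
        unfolding row[OF i(1) w(1)] sum_vs by (rule sum.cong) (auto simp: f i)
      then show ?thesis
        using w i f by simp
    qed
    ultimately show ?R by blast
  next
    assume ?R
    then obtain f where f: "\<exists>v \<in> set vs. f v \<noteq> 0"
      "\<forall>v \<in> set vs. (\<Sum>u \<in> set vs. (if (v, u) \<in> parcs G then f u else 0)) = x * f v" by blast
    define w where "w = vec ?n (\<lambda>i. f (vs ! i))"
    have w: "w \<in> carrier_vec ?n" by (simp add: w_def)
    moreover have "w \<noteq> 0\<^sub>v ?n"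
      using f(1) by (auto simp: w_def vec_eq_iff in_set_conv_nth)
    moreover have "adjacency_mat G vs *\<^sub>v w = x \<cdot>\<^sub>v w"
    proof (rule eq_vecI)
      fix i assume "i < dim_vec (x \<cdot>\<^sub>v w)"
      then have i: "i < ?n" by (simp add: w_def)
      have "(adjacency_mat G vs *\<^sub>v w) $ i =
          (\<Sum>u \<in> set vs. (if (vs ! i, u) \<in> parcs G then f u else 0))"
        unfolding row[OF i w] sum_vs by (rule sum.cong) (auto simp: w_def)
      then show "(adjacency_mat G vs *\<^sub>v w) $ i = (x \<cdot>\<^sub>v w) $ i"
        using f(2) i by (simp add: w_def)
    qed (simp add: adjacency_mat_def w_def)
    ultimately show ?L
      unfolding eigenvalue_def eigenvector_def by (auto simp: adjacency_mat_def)
  qed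
qed

lemma eigenvalue_adjacency_mat_cong:
  assumes "distinct vs" "distinct ws" "set vs = set ws"
  shows "eigenvalue (adjacency_mat G vs) = eigenvalue (adjacency_mat G ws)"
  using assms by (intro ext) (simp add: eigenvalue_adjacency_mat_iff)

end

theory Submission
  imports Defs "HOL-Analysis.Convex" "Jordan_Normal_Form.Spectral_Radius"
begin

text \<open>
  Put \<open>m = n/2\<close>. The extremal graph has an explicit positive eigenfunction whose eigenvalue
  \<open>\<theta>\<close> satisfies \<open>\<theta>\<^sup>2 > m (m - 1)\<close>, while the square of any eigenvalue of a bipartite graph is at
  most its number of edges; hence \<open>G\<close> misses fewer than \<open>m\<close> edges of \<open>K\<^sub>m\<^sub>,\<^sub>m\<close>. By Ore's criterion, a
  graph without \<open>k\<close>-factor has sets \<open>S \<subseteq> X\<close>, \<open>T \<subseteq> Y\<close> spanning fewer than \<open>k (|S| + |T| - m)\<close> edges.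
  With so few edges missing, this forces \<open>S = X\<close> or \<open>T = Y\<close>, and then averaging yields a vertex of
  degree less than \<open>k\<close>. So \<open>G\<close> is a spanning subgraph of the extremal graph, and by Perron-Frobenius
  a proper connected subgraph would have smaller spectral radius.
\<close>

section \<open>Regular spanning subgraphs of bipartite graphs\<close>

lemma card_Int_Times_eq_sum:
  assumes "finite S" "finite T"
  shows "card (E \<inter> S \<times> T) = (\<Sum>x\<in>S. card (E `` {x} \<inter> T))"
proof -
  have "E \<inter> S \<times> T = (SIGMA x:S. E `` {x} \<inter> T)" by auto
  then show ?thesis using assms by simp
qed

lemma card_converse_Int_Times: "card (E\<inverse> \<inter> T \<times> S) = card (E \<inter> S \<times> T)"
proof -
  have "E\<inverse> \<inter> T \<times> S = (E \<inter> S \<times> T)\<inverse>" by auto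
  then show ?thesis by simp
qed

text \<open>Submodularity of edge counts: \<open>?C \<union> ?D\<close> lies in
  \<open>?A \<union> ?B\<close> and \<open>?C \<inter> ?D\<close> lies in
  \<open>?A \<inter> ?B\<close>, so no edge is counted more often on the left than on the
  right.\<close>

lemma card_Int_Times_uncross:
  assumes "finite E"
  shows "card (E \<inter> (S \<inter> S') \<times> (T \<union> T')) + card (E \<inter> (S \<union> S') \<times> (T \<inter> T'))
    \<le> card (E \<inter> S \<times> T) + card (E \<inter> S' \<times> T')"
    (is "card ?C + card ?D \<le> card ?A + card ?B")
proof -
  have "card ?C + card ?D = card (?C \<union> ?D) + card (?C \<inter> ?D)"
    using assms by (intro card_Un_Int) auto
  also have "\<dots> \<le> card (?A \<union> ?B) + card (?A \<inter> ?B)"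
    using assms by (intro add_mono card_mono) auto
  also have "\<dots> = card ?A + card ?B"
    using assms by (intro card_Un_Int[symmetric]) auto
  finally show ?thesis .
qed

text \<open>
  Ore's criterion, proved without flows: in an edge-minimal subgraph satisfying the cut condition
  every edge lies in a tight pair, and by submodularity the tight pairs of all edges at a vertex
  \<open>x\<close> combine to one tight pair \<open>(S, T)\<close> with \<open>x \<in> S\<close> and \<open>T\<close> containing all neighbours of \<open>x\<close>.
  Removing \<open>x\<close> from \<open>S\<close> bounds the degree of \<open>x\<close> by \<open>k\<close>.
\<close>

theorem bipartite_regular_subgraph:
  assumes fin: "finite X" "finite Y" and cX: "card X = m" and cY: "card Y = m"
    and E: "E \<subseteq> X \<times> Y"
    and cut: "\<And>S T. S \<subseteq> X \<Longrightarrow> T \<subseteq> Y \<Longrightarrow> k * (card S + card T) \<le> k * m + card (E \<inter> S \<times> T)"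
  obtains F where "F \<subseteq> E" "\<And>x. x \<in> X \<Longrightarrow> card (F `` {x}) = k"
    "\<And>y. y \<in> Y \<Longrightarrow> card (F\<inverse> `` {y}) = k"
proof -
  define P where "P F \<longleftrightarrow> F \<subseteq> E \<and>
    (\<forall>S T. S \<subseteq> X \<longrightarrow> T \<subseteq> Y \<longrightarrow> k * (card S + card T) \<le> k * m + card (F \<inter> S \<times> T))" for F
  have "P E" using cut by (auto simp: P_def)
  then obtain F where PF: "P F" and minimal: "\<And>F'. P F' \<Longrightarrow> card F \<le> card F'"
    using ex_has_least_nat[of P E card] by blast
  have FE: "F \<subseteq> E" and cutF: "\<And>S T. S \<subseteq> X \<Longrightarrow> T \<subseteq> Y \<Longrightarrow>
      k * (card S + card T) \<le> k * m + card (F \<inter> S \<times> T)"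
    using PF by (auto simp: P_def)
  have FXY: "F \<subseteq> X \<times> Y" using FE E by auto
  have finF: "finite F" using finite_subset[OF FXY] fin by simp
  define tight where "tight S T \<longleftrightarrow> S \<subseteq> X \<and> T \<subseteq> Y \<and>
    k * (card S + card T) = k * m + card (F \<inter> S \<times> T)" for S T
  have tight_edge: "\<exists>S T. tight S T \<and> x \<in> S \<and> y \<in> T" if xy: "(x, y) \<in> F" for x y
  proof -
    have "card (F - {(x, y)}) < card F" using xy finF by (intro psubset_card_mono) auto
    then have "\<not> P (F - {(x, y)})" using minimal leD by blast
    then obtain S T where ST: "S \<subseteq> X" "T \<subseteq> Y"
      "k * m + card ((F - {(x, y)}) \<inter> S \<times> T) < k * (card S + card T)"
      using FE by (auto simp: P_def not_le)
    have eq: "(F - {(x, y)}) \<inter> S \<times> T = F \<inter> S \<times> T - {(x, y)}" by auto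
    have in_ST: "(x, y) \<in> S \<times> T"
    proof (rule ccontr)
      assume "(x, y) \<notin> S \<times> T"
      then have "(F - {(x, y)}) \<inter> S \<times> T = F \<inter> S \<times> T" by auto
      then show False using ST cutF[OF ST(1,2)] by simp
    qed
    \<comment> \<open>Deleting one edge lowers the count by exactly one. The cut condition holds for
      \<open>F\<close> and fails after the deletion, so it is an equality for
      \<open>F\<close>.\<close>
    then have "card (F \<inter> S \<times> T - {(x, y)}) = card (F \<inter> S \<times> T) - 1"
      using xy by (intro card_Diff_singleton) auto
    then have "tight S T" using ST cutF[OF ST(1,2)] by (simp add: tight_def eq)
    then show ?thesis using in_ST by auto
  qed
  have tight_uncross: "tight (S \<inter> S') (T \<union> T')" if "tight S T" "tight S' T'" for S T S' T'
  proof -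
    have sub: "S \<subseteq> X" "S' \<subseteq> X" "T \<subseteq> Y" "T' \<subseteq> Y" using that by (auto simp: tight_def)
    then have "finite S" "finite S'" "finite T" "finite T'" using fin finite_subset by blast+
    \<comment> \<open>Cardinalities are modular, while edge counts obey only the uncrossing
      inequality. The cut condition bounds both new pairs from the other side, so neither has any
      slack.\<close>
    then have "k * (card S + card S' + (card T + card T')) =
        k * (card (S \<union> S') + card (S \<inter> S') + (card (T \<union> T') + card (T \<inter> T')))"
      using card_Un_Int[of S S'] card_Un_Int[of T T'] by simp
    moreover have "k * (card (S \<inter> S') + card (T \<union> T')) \<le>
        k * m + card (F \<inter> (S \<inter> S') \<times> (T \<union> T'))"
      "k * (card (S \<union> S') + card (T \<inter> T')) \<le> k * m + card (F \<inter> (S \<union> S') \<times> (T \<inter> T'))"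
      using sub by (auto intro!: cutF)
    moreover have "k * (card S + card T) = k * m + card (F \<inter> S \<times> T)"
      "k * (card S' + card T') = k * m + card (F \<inter> S' \<times> T')"
      using that by (auto simp: tight_def)
    ultimately have "k * (card (S \<inter> S') + card (T \<union> T')) =
        k * m + card (F \<inter> (S \<inter> S') \<times> (T \<union> T'))"
      using card_Int_Times_uncross[OF finF, of S S' T T'] by (simp add: distrib_left)
    then show ?thesis using sub by (auto simp: tight_def)
  qed
  have tight_nbrs: "\<exists>S T. tight S T \<and> x \<in> S \<and> N \<subseteq> T"
    if "finite N" "N \<noteq> {}" "N \<subseteq> F `` {x}" for x N
    using that
  proof (induction N rule: finite_ne_induct)
    case (singleton y)
    then show ?case using tight_edge[of x y] by auto
  next
    case (insert y N)
    then obtain S T S' T' where "tight S T" "x \<in> S" "N \<subseteq> T" "tight S' T'" "x \<in> S'" "y \<in> T'"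
      using tight_edge[of x y] by auto
    then show ?case
      by (intro exI[of _ "S \<inter> S'"] exI[of _ "T \<union> T'"]) (auto intro: tight_uncross)
  qed
  have deg_X: "card (F `` {x}) = k" if x: "x \<in> X" for x
  proof (rule antisym)
    show "k \<le> card (F `` {x})"
    proof -
      have "F `` {x} \<inter> Y = F `` {x}" using FXY by auto
      then show ?thesis
        using cutF[of "{x}" Y] x cY fin card_Int_Times_eq_sum[of "{x}" Y F] by simp
    qed
    show "card (F `` {x}) \<le> k"
    proof (cases "F `` {x} = {}")
      case False
      moreover have "finite (F `` {x})" using finF by (rule finite_Image)
      ultimately obtain S T where ST: "tight S T" "x \<in> S" "F `` {x} \<subseteq> T"
        using tight_nbrs[of "F `` {x}" x] by auto
      have fST: "finite S" "finite T" using ST(1) fin finite_subset unfolding tight_def by blast+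
      have "card (F \<inter> S \<times> T) = card (F `` {x}) + card (F \<inter> (S - {x}) \<times> T)"
        using fST ST by (simp add: card_Int_Times_eq_sum sum.remove Int_absorb2)
      moreover have "k * (card (S - {x}) + card T) \<le> k * m + card (F \<inter> (S - {x}) \<times> T)"
        using ST by (intro cutF) (auto simp: tight_def)
      moreover have "card S = Suc (card (S - {x}))"
        using fST ST by (metis card.remove)
      ultimately show ?thesis using ST(1) by (simp add: tight_def)
    qed simp
  qed
  have deg_Y_ge: "k \<le> card (F\<inverse> `` {y})" if y: "y \<in> Y" for y
  proof -
    have "F\<inverse> `` {y} \<inter> X = F\<inverse> `` {y}" using FXY by auto
    then show ?thesis
      using cutF[of X "{y}"] y cX fin card_Int_Times_eq_sum[of "{y}" X "F\<inverse>"]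
        card_converse_Int_Times[of F "{y}" X] by simp
  qed
  \<comment> \<open>On the \<open>Y\<close> side the cut condition gives only lower bounds. Counting
    the edges of \<open>F\<close> from \<open>X\<close> shows that the degrees total
    \<open>k * m\<close>, so every bound is attained.\<close>
  have sum_Y: "(\<Sum>y\<in>Y. card (F\<inverse> `` {y})) = k * m"
  proof -
    have "(\<Sum>y\<in>Y. card (F\<inverse> `` {y})) = (\<Sum>y\<in>Y. card (F\<inverse> `` {y} \<inter> X))"
      using FXY by (intro sum.cong arg_cong[where f = card]) auto
    also have "\<dots> = card (F \<inter> X \<times> Y)"
      using card_Int_Times_eq_sum[OF fin(2,1), of "F\<inverse>"] card_converse_Int_Times[of F Y X] by simp
    also have "\<dots> = (\<Sum>x\<in>X. card (F `` {x} \<inter> Y))"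
      using fin by (rule card_Int_Times_eq_sum)
    also have "\<dots> = (\<Sum>x\<in>X. card (F `` {x}))"
      using FXY by (intro sum.cong arg_cong[where f = card]) auto
    also have "\<dots> = k * m" using deg_X cX by simp
    finally show ?thesis .
  qed
  have "card (F\<inverse> `` {y}) = k" if "y \<in> Y" for y
    using sum_mono_inv[of "\<lambda>_. k" Y "\<lambda>y. card (F\<inverse> `` {y})" y] sum_Y that deg_Y_ge fin cY
    by simp
  then show ?thesis using that FE deg_X by blast
qed

text \<open>Averaging over \<open>S\<close>; it turns a violated cut inequality whose other side is
  full into a vertex of small degree.\<close>

lemma exists_low_degree:
  assumes "finite S" "S \<subseteq> X" "finite Y" "E \<subseteq> X \<times> Y" "card (E \<inter> S \<times> Y) < k * card S"
  shows "\<exists>x\<in>X. card (E `` {x}) < k"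
proof (rule ccontr)
  assume "\<not> ?thesis"
  then have "k \<le> card (E `` {x})" if "x \<in> S" for x using that assms by force
  then have "(\<Sum>x\<in>S. k) \<le> (\<Sum>x\<in>S. card (E `` {x}))" by (rule sum_mono)
  also have "\<dots> = (\<Sum>x\<in>S. card (E `` {x} \<inter> Y))"
    using assms by (intro sum.cong arg_cong[where f = card]) auto
  also have "\<dots> = card (E \<inter> S \<times> Y)"
    using assms by (simp add: card_Int_Times_eq_sum)
  finally show False using assms by (simp add: mult.commute)
qed

text \<open>By Ore's criterion a failure yields a violating pair. If one side is full, averaging
  contradicts the degree bounds. If both sides are proper, at least \<open>m\<close> edges are
  missing inside \<open>S \<times> T\<close>, whereas \<open>dense\<close> allows at most
  \<open>m - 1\<close>.\<close>

lemma dense_bipartite_regular_subgraph: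
  assumes fin: "finite X" "finite Y" and cX: "card X = m" and cY: "card Y = m"
    and E: "E \<subseteq> X \<times> Y" and k: "k < m" and dense: "m * (m - 1) < card E"
    and deg: "\<And>x. x \<in> X \<Longrightarrow> k \<le> card (E `` {x})" "\<And>y. y \<in> Y \<Longrightarrow> k \<le> card (E\<inverse> `` {y})"
  obtains F where "F \<subseteq> E" "\<And>x. x \<in> X \<Longrightarrow> card (F `` {x}) = k"
    "\<And>y. y \<in> Y \<Longrightarrow> card (F\<inverse> `` {y}) = k"
proof (rule bipartite_regular_subgraph[OF fin cX cY E])
  fix S T assume ST: "S \<subseteq> X" "T \<subseteq> Y"
  show "k * (card S + card T) \<le> k * m + card (E \<inter> S \<times> T)"
  proof (rule ccontr)
    assume "\<not> ?thesis"
    then have viol: "k * m + card (E \<inter> S \<times> T) < k * (card S + card T)" by simp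
    have fST: "finite S" "finite T" using ST fin finite_subset by blast+
    have le: "card S \<le> m" "card T \<le> m" using card_mono[OF fin(1) ST(1)] card_mono[OF fin(2) ST(2)] cX cY by auto
    consider "card T = m" | "card S = m" | "card S < m" "card T < m" using le by linarith
    then show False
    proof cases
      case 1
      then have "T = Y" using ST fin cY card_subset_eq by metis
      then have "card (E \<inter> S \<times> Y) < k * card S" using viol 1 by (simp add: distrib_left)
      then have "\<exists>x\<in>X. card (E `` {x}) < k"
        using exists_low_degree[of S X Y E k] fin fST ST E by blast
      then show False using deg(1) leD by blast
    next
      case 2
      then have "S = X" using ST fin cX card_subset_eq by metis
      then have "card (E\<inverse> \<inter> T \<times> X) < k * card T"
        using viol 2 by (simp add: distrib_left card_converse_Int_Times)
      moreover have "E\<inverse> \<subseteq> Y \<times> X" using E by auto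
      ultimately have "\<exists>y\<in>Y. card (E\<inverse> `` {y}) < k"
        using exists_low_degree[of T Y X "E\<inverse>" k] fin fST ST by blast
      then show False using deg(2) leD by blast
    next
      case 3
      \<comment> \<open>\<open>Suc p\<close> and \<open>Suc q\<close> count the vertices outside
        \<open>S\<close> and \<open>T\<close>. \<open>Suc r\<close> is the excess of
        \<open>card S + card T\<close> over \<open>m\<close>, positive because the cut inequality is
        trivial otherwise. All sizes become sums in \<open>p\<close>, \<open>q\<close>,
        \<open>r\<close>, free of subtraction.\<close>
      obtain p where p: "m = card S + Suc p" using 3(1) less_iff_Suc_add by (metis add_Suc_right)
      obtain q where q: "m = card T + Suc q" using 3(2) less_iff_Suc_add by (metis add_Suc_right)
      have "m < card S + card T"
      proof (rule ccontr)
        assume "\<not> ?thesis"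
        then have "k * (card S + card T) \<le> k * m" by (intro mult_le_mono2) simp
        then show False using viol by linarith
      qed
      then obtain r where r: "card S + card T = m + Suc r"
        using less_iff_Suc_add by (metis add_Suc_right)
      have s: "card S = Suc q + Suc r" and t: "card T = Suc p + Suc r"
        and m: "m = Suc p + Suc q + Suc r"
        using p q r by linarith+
      have "card E \<le> card (E \<inter> S \<times> T) + card (X \<times> Y - S \<times> T)"
      proof -
        have "E \<subseteq> (E \<inter> S \<times> T) \<union> (X \<times> Y - S \<times> T)" using E by auto
        then have "card E \<le> card ((E \<inter> S \<times> T) \<union> (X \<times> Y - S \<times> T))"
          using fin fST by (intro card_mono) auto
        also have "\<dots> \<le> card (E \<inter> S \<times> T) + card (X \<times> Y - S \<times> T)" by (rule card_Un_le)
        finally show ?thesis .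
      qed
      moreover have "card (X \<times> Y - S \<times> T) + card S * card T = m * m"
      proof -
        have "card (X \<times> Y - S \<times> T) = card (X \<times> Y) - card (S \<times> T)"
          using ST fST by (intro card_Diff_subset) auto
        moreover have "card (S \<times> T) \<le> card (X \<times> Y)" using ST fin by (intro card_mono) auto
        ultimately show ?thesis using cX cY by (simp add: card_cartesian_product)
      qed
      moreover have "card (E \<inter> S \<times> T) < k * Suc r"
        using viol r by (simp add: distrib_left)
      moreover have "k * Suc r \<le> (m - 1) * Suc r" using k by (intro mult_le_mono1) simp
      ultimately have "card E + card S * card T < m * m + (m - 1) * Suc r" by linarith
      then have "m * (m - 1) + 1 + card S * card T < m * m + (m - 1) * Suc r"
        using dense by linarith
      \<comment> \<open>Since \<open>card S * card T = Suc p * Suc q + m * Suc r\<close>, the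
        inequality collapses to \<open>p * q < 0\<close>.\<close>
      then show False unfolding s t m by (simp add: algebra_simps)
    qed
  qed
qed (use that in blast)

section \<open>Eigenfunctions of graphs\<close>

text \<open>The adjacency operator acting on functions. It takes a bare arc set so that it also
  applies to relations pulled back along a bijection.\<close>

definition nbr_sum :: "('a \<times> 'a) set \<Rightarrow> 'a set \<Rightarrow> ('a \<Rightarrow> real) \<Rightarrow> 'a \<Rightarrow> real" where
  "nbr_sum A V f v = (\<Sum>u\<in>V. if (v, u) \<in> A then f u else 0)"

text \<open>A complex eigenvector \<open>w\<close> exists. The Hermitian form \<open>Q\<close> of
  \<open>w\<close> equals its own conjugate, which makes \<open>z\<close> real, and \<open>z\<close>
  is then a root of the real characteristic polynomial.\<close>

lemma symmetric_real_mat_eigenvalue: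
  fixes M :: "real mat"
  assumes M: "M \<in> carrier_mat n n" and n: "n > 0"
    and sym: "\<And>i j. i < n \<Longrightarrow> j < n \<Longrightarrow> M $$ (i, j) = M $$ (j, i)"
  shows "\<exists>x. eigenvalue M x"
proof -
  let ?C = "map_mat complex_of_real M"
  have C: "?C \<in> carrier_mat n n" using M by simp
  obtain z where z: "eigenvalue ?C z"
    using spectrum_non_empty[OF C n] by (auto simp: spectrum_def)
  then obtain w where w: "w \<in> carrier_vec n" "w \<noteq> 0\<^sub>v n" "?C *\<^sub>v w = z \<cdot>\<^sub>v w"
    using C by (auto simp: eigenvalue_def eigenvector_def)
  have row: "(\<Sum>j = 0..<n. complex_of_real (M $$ (i, j)) * w $ j) = z * w $ i" if "i < n" for i
  proof -
    have "(?C *\<^sub>v w) $ i = (\<Sum>j = 0..<n. complex_of_real (M $$ (i, j)) * w $ j)"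
      using that M w(1) by (auto simp: scalar_prod_def intro!: sum.cong)
    then show ?thesis using w that by simp
  qed
  define N where "N = (\<Sum>i = 0..<n. (cmod (w $ i))\<^sup>2)"
  obtain i where i: "i < n" "w $ i \<noteq> 0" using w(1,2) by (auto simp: vec_eq_iff)
  then have "N > 0"
    unfolding N_def by (intro sum_pos2[of _ i]) auto
  define Q where "Q = (\<Sum>i = 0..<n. \<Sum>j = 0..<n. cnj (w $ i) * complex_of_real (M $$ (i, j)) * w $ j)"
  have "Q = (\<Sum>i = 0..<n. cnj (w $ i) * (z * w $ i))"
    unfolding Q_def by (intro sum.cong refl) (simp add: row[symmetric] sum_distrib_left mult.assoc)
  also have "\<dots> = z * complex_of_real N"
    unfolding N_def of_real_sum sum_distrib_left
    by (intro sum.cong refl) (simp add: complex_norm_square[symmetric] mult_ac flip: of_real_power)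
  finally have Q: "Q = z * complex_of_real N" .
  have "cnj Q = (\<Sum>i = 0..<n. \<Sum>j = 0..<n. cnj (w $ j) * complex_of_real (M $$ (j, i)) * w $ i)"
    unfolding Q_def cnj_sum by (intro sum.cong refl) (auto simp: sym mult_ac)
  also have "\<dots> = Q" unfolding Q_def by (rule sum.swap)
  finally have "cnj z * complex_of_real N = z * complex_of_real N" using Q by simp
  then have "cnj z = z" using \<open>N > 0\<close> by simp
  then have "z = complex_of_real (Re z)" by (metis Reals_cnj_iff of_real_Re)
  moreover have "poly (char_poly ?C) z = 0"
    using z eigenvalue_root_char_poly[OF C] by simp
  moreover have "char_poly ?C = map_poly complex_of_real (char_poly M)"
    by (rule of_real_hom.char_poly_hom[OF M])
  ultimately have "poly (map_poly complex_of_real (char_poly M)) (complex_of_real (Re z)) = 0"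
    by metis
  then have "poly (char_poly M) (Re z) = 0" by simp
  then show ?thesis using eigenvalue_root_char_poly[OF M] by blast
qed

text \<open>The spectral radius is a \<open>Max\<close>, so its set must be finite and nonempty:
  finiteness is that of a matrix spectrum, nonemptiness comes from the symmetry of the arcs. From
  here on only functions on vertices occur.\<close>

lemma eigenvalue_graph_spectral_radius:
  fixes G :: "'a pair_pre_digraph"
  assumes "pair_graph G" "pverts G \<noteq> {}"
  shows "\<exists>f. (\<exists>v\<in>pverts G. f v \<noteq> 0) \<and>
      (\<forall>v\<in>pverts G. nbr_sum (parcs G) (pverts G) f v = graph_spectral_radius G * f v)"
    and "(\<exists>v\<in>pverts G. f v \<noteq> 0) \<Longrightarrow>
      (\<forall>v\<in>pverts G. nbr_sum (parcs G) (pverts G) f v = x * f v) \<Longrightarrow> x \<le> graph_spectral_radius G"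
proof -
  interpret pair_graph G by fact
  define vs where "vs = (SOME vs. distinct vs \<and> set vs = pverts G)"
  have vs: "distinct vs" "set vs = pverts G"
  proof -
    have "\<exists>vs. distinct vs \<and> set vs = pverts G"
      using finite_distinct_list[OF pair_finite_verts] by blast
    then have "distinct vs \<and> set vs = pverts G" unfolding vs_def by (rule someI_ex)
    then show "distinct vs" "set vs = pverts G" by auto
  qed
  let ?M = "adjacency_mat G vs"
  have M: "?M \<in> carrier_mat (length vs) (length vs)" by (simp add: adjacency_mat_def)
  have iff: "eigenvalue ?M x \<longleftrightarrow> (\<exists>f. (\<exists>v\<in>pverts G. f v \<noteq> 0) \<and>
      (\<forall>v\<in>pverts G. nbr_sum (parcs G) (pverts G) f v = x * f v))" for x
    using eigenvalue_adjacency_mat_iff[OF vs(1), of G x] vs(2) by (simp add: nbr_sum_def)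
  have fin: "finite {x. eigenvalue ?M x}"
    using card_finite_spectrum(1)[OF M] by (simp add: spectrum_def)
  have sr: "graph_spectral_radius G = Max {x. eigenvalue ?M x}"
    by (simp add: graph_spectral_radius_def vs_def)
  have "(a, b) \<in> parcs G \<Longrightarrow> (b, a) \<in> parcs G" for a b
    using arcs_symmetric by blast
  then have "\<exists>x. eigenvalue ?M x"
    using assms(2) vs by (intro symmetric_real_mat_eigenvalue[OF M]) (auto simp: adjacency_mat_def)
  then have "eigenvalue ?M (graph_spectral_radius G)"
    using Max_in[OF fin] by (auto simp: sr)
  then show "\<exists>f. (\<exists>v\<in>pverts G. f v \<noteq> 0) \<and>
      (\<forall>v\<in>pverts G. nbr_sum (parcs G) (pverts G) f v = graph_spectral_radius G * f v)"
    by (simp add: iff)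
  show "x \<le> graph_spectral_radius G" if "\<exists>v\<in>pverts G. f v \<noteq> 0"
      "\<forall>v\<in>pverts G. nbr_sum (parcs G) (pverts G) f v = x * f v"
    using Max_ge[OF fin, of x] that iff[of x] by (auto simp: sr)
qed

text \<open>Cauchy-Schwarz at each vertex of one part, summed over that part, bounds its squared
  norm times \<open>x\<^sup>2\<close> by the number of edges times the squared norm of the other
  part (\<open>half\<close>). Adding both directions lets the total norm cancel.\<close>

lemma bipartite_eigenvalue_bound:
  assumes fin: "finite X" "finite Y" and disj: "X \<inter> Y = {}"
    and A: "A \<subseteq> X \<times> Y \<union> Y \<times> X" and sym: "\<And>u v. (u, v) \<in> A \<Longrightarrow> (v, u) \<in> A"
    and nz: "\<exists>v\<in>X \<union> Y. f v \<noteq> 0"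
    and ev: "\<And>v. v \<in> X \<union> Y \<Longrightarrow> nbr_sum A (X \<union> Y) f v = x * f v"
  shows "x\<^sup>2 \<le> card (A \<inter> X \<times> Y)"
proof -
  have half: "x\<^sup>2 * (\<Sum>v\<in>P. (f v)\<^sup>2) \<le> card (A \<inter> P \<times> R) * (\<Sum>u\<in>R. (f u)\<^sup>2)"
    if PR: "finite P" "finite R" "P \<union> R = X \<union> Y" "A `` P \<subseteq> R" for P R
  proof -
    have "x\<^sup>2 * (f v)\<^sup>2 \<le> card (A `` {v} \<inter> R) * (\<Sum>u\<in>R. (f u)\<^sup>2)" if v: "v \<in> P" for v
    proof -
      let ?N = "A `` {v} \<inter> R"
      have fN: "finite ?N" using PR by simp
      have "x * f v = (\<Sum>u\<in>X \<union> Y. if (v, u) \<in> A then f u else 0)"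
        using ev[of v] v PR(3) unfolding nbr_sum_def by (metis UnI1)
      also have "\<dots> = sum f ?N"
        using PR v fin by (intro sum.mono_neutral_cong_right) auto
      finally have "x\<^sup>2 * (f v)\<^sup>2 = (\<Sum>u\<in>?N. 1 * f u)\<^sup>2" by (simp add: power_mult_distrib[symmetric])
      also have "\<dots> \<le> (\<Sum>u\<in>?N. 1\<^sup>2) * (\<Sum>u\<in>?N. (f u)\<^sup>2)" by (rule Cauchy_Schwarz_ineq_sum)
      also have "\<dots> \<le> card ?N * (\<Sum>u\<in>R. (f u)\<^sup>2)"
        using PR by (auto intro!: mult_left_mono sum_mono2)
      finally show ?thesis .
    qed
    then have "(\<Sum>v\<in>P. x\<^sup>2 * (f v)\<^sup>2) \<le> (\<Sum>v\<in>P. card (A `` {v} \<inter> R) * (\<Sum>u\<in>R. (f u)\<^sup>2))"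
      by (intro sum_mono) simp
    then show ?thesis
      using PR by (simp add: card_Int_Times_eq_sum flip: sum_distrib_left sum_distrib_right)
  qed
  have AX: "A `` X \<subseteq> Y" and AY: "A `` Y \<subseteq> X" using A disj by auto
  have "A\<inverse> = A" using sym by auto
  then have card_eq: "card (A \<inter> Y \<times> X) = card (A \<inter> X \<times> Y)"
    using card_converse_Int_Times[of A Y X] by simp
  let ?s = "\<Sum>v\<in>X \<union> Y. (f v)\<^sup>2"
  have s: "?s = (\<Sum>v\<in>X. (f v)\<^sup>2) + (\<Sum>v\<in>Y. (f v)\<^sup>2)" using fin disj by (rule sum.union_disjoint)
  have "x\<^sup>2 * ?s \<le> card (A \<inter> X \<times> Y) * ?s"
    using half[of X Y] half[of Y X] fin AX AY card_eq unfolding s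
    by (simp add: distrib_left Un_commute)
  moreover have "?s > 0"
    using nz fin by (auto intro!: sum_pos2)
  ultimately show ?thesis by simp
qed

text \<open>
  Pairing \<open>\<bar>g\<bar>\<close> with the positive eigenfunction \<open>f\<close> of the larger graph forces equality in
  \<open>\<rho> \<bar>g\<bar> \<le> A \<bar>g\<bar> \<le> B \<bar>g\<bar>\<close>, so \<open>\<bar>g\<bar>\<close> is an eigenfunction of both graphs; connectedness makes it
  positive, hence it detects every arc of \<open>B\<close> that is not in \<open>A\<close>.
\<close>

lemma perron_comparison:
  assumes fin: "finite V" and AB: "A \<subseteq> B"
    and symA: "\<And>u v. (u, v) \<in> A \<Longrightarrow> (v, u) \<in> A" and symB: "\<And>u v. (u, v) \<in> B \<Longrightarrow> (v, u) \<in> B"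
    and fpos: "\<And>v. v \<in> V \<Longrightarrow> f v > 0"
    and evB: "\<And>v. v \<in> V \<Longrightarrow> nbr_sum B V f v = \<theta> * f v"
    and gnz: "\<exists>v\<in>V. g v \<noteq> 0"
    and evA: "\<And>v. v \<in> V \<Longrightarrow> nbr_sum A V g v = \<rho> * g v"
    and \<theta>: "0 < \<theta>" "\<theta> \<le> \<rho>"
    and conn: "\<And>S. S \<subseteq> V \<Longrightarrow> S \<noteq> {} \<Longrightarrow> (\<And>u v. u \<in> S \<Longrightarrow> v \<in> V \<Longrightarrow> (u, v) \<in> A \<Longrightarrow> v \<in> S) \<Longrightarrow> S = V"
  shows "B \<inter> V \<times> V \<subseteq> A"
proof -
  define y where "y v = \<bar>g v\<bar>" for v
  have A_ge: "\<theta> * y v \<le> nbr_sum A V y v" if "v \<in> V" for v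
  proof -
    have "\<theta> * y v \<le> \<rho> * y v" using \<theta> by (intro mult_right_mono) (auto simp: y_def)
    also have "\<dots> = \<bar>nbr_sum A V g v\<bar>" using evA[OF that] \<theta> by (simp add: abs_mult y_def)
    also have "\<dots> \<le> nbr_sum A V y v"
      unfolding nbr_sum_def by (rule order_trans[OF sum_abs]) (auto intro!: sum_mono simp: y_def)
    finally show ?thesis .
  qed
  have AB_le: "nbr_sum A V y v \<le> nbr_sum B V y v" for v
    unfolding nbr_sum_def using AB by (intro sum_mono) (auto simp: y_def)
  \<comment> \<open>Symmetry of \<open>B\<close> moves the operator from \<open>y\<close> to
    \<open>f\<close>, where it acts as \<open>\<theta>\<close>. So the nonnegative terms considered
    next add up to zero.\<close>
  have "(\<Sum>v\<in>V. f v * nbr_sum B V y v) = (\<Sum>v\<in>V. \<Sum>u\<in>V. if (v, u) \<in> B then f v * y u else 0)"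
    unfolding nbr_sum_def sum_distrib_left by (intro sum.cong refl) auto
  also have "\<dots> = (\<Sum>u\<in>V. \<Sum>v\<in>V. if (v, u) \<in> B then f v * y u else 0)" by (rule sum.swap)
  also have "\<dots> = (\<Sum>u\<in>V. y u * nbr_sum B V f u)"
    unfolding nbr_sum_def sum_distrib_left by (intro sum.cong refl) (auto dest: symB)
  also have "\<dots> = (\<Sum>u\<in>V. f u * (\<theta> * y u))"
    by (intro sum.cong refl) (simp add: evB)
  finally have "(\<Sum>v\<in>V. f v * (nbr_sum B V y v - \<theta> * y v)) = 0"
    by (simp add: right_diff_distrib sum_subtractf)
  moreover have "0 \<le> f v * (nbr_sum B V y v - \<theta> * y v)" if "v \<in> V" for v
    using fpos[OF that] A_ge[OF that] AB_le[of v] by simp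
  ultimately have "\<forall>v\<in>V. f v * (nbr_sum B V y v - \<theta> * y v) = 0"
    using sum_nonneg_eq_0_iff[OF fin, of "\<lambda>v. f v * (nbr_sum B V y v - \<theta> * y v)"] by blast
  then have evBy: "nbr_sum B V y v = \<theta> * y v" if "v \<in> V" for v
    using fpos[OF that] that by auto
  have evAy: "nbr_sum A V y v = \<theta> * y v" if "v \<in> V" for v
    using evBy[OF that] A_ge[OF that] AB_le[of v] by simp
  have "{v \<in> V. y v > 0} = V"
  proof (rule conn)
    show "{v \<in> V. y v > 0} \<noteq> {}" using gnz by (auto simp: y_def)
    fix u v assume uv: "u \<in> {v \<in> V. y v > 0}" "v \<in> V" "(u, v) \<in> A"
    then have "0 < y u" by simp
    also have "y u = (if (v, u) \<in> A then y u else 0)" using symA uv(3) by simp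
    also have "\<dots> \<le> nbr_sum A V y v"
      unfolding nbr_sum_def
      by (rule member_le_sum[of u V "\<lambda>u. if (v, u) \<in> A then y u else 0"])
        (use fin uv in \<open>auto simp: y_def\<close>)
    also have "\<dots> = \<theta> * y v" using evAy uv by simp
    finally show "v \<in> {v \<in> V. y v > 0}" using \<theta> uv by (simp add: zero_less_mult_iff)
  qed auto
  then have ypos: "y v > 0" if "v \<in> V" for v using that by auto
  show ?thesis
  proof safe
    fix v u assume vu: "(v, u) \<in> B" "v \<in> V" "u \<in> V"
    show "(v, u) \<in> A"
    proof (rule ccontr)
      assume "(v, u) \<notin> A"
      then have "nbr_sum A V y v < nbr_sum B V y v"
        unfolding nbr_sum_def using vu fin ypos AB
        by (intro sum_strict_mono_ex1) (auto simp: y_def intro!: bexI[of _ u])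
      then show False using evAy evBy vu by simp
    qed
  qed
qed

section \<open>The extremal graph\<close>

text \<open>The deleted star has the leaves \<open>Inr j\<close> with \<open>j < m - k + 1\<close>,
  whence \<open>m - k < j\<close>; for \<open>1 \<le> k\<close> and \<open>k \<le> m\<close> the
  vertex \<open>Inl 0\<close> keeps \<open>k - 1\<close> neighbours.\<close>

lemma parcs_extremal_graph [simp]:
  "(Inl i, Inr j) \<in> parcs (extremal_graph m k) \<longleftrightarrow> i < m \<and> j < m \<and> (i = 0 \<longrightarrow> m - k < j)"
  "(Inr j, Inl i) \<in> parcs (extremal_graph m k) \<longleftrightarrow> i < m \<and> j < m \<and> (i = 0 \<longrightarrow> m - k < j)"
  "(Inl i, Inl i') \<notin> parcs (extremal_graph m k)"
  "(Inr j, Inr j') \<notin> parcs (extremal_graph m k)"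
  by (auto simp: extremal_graph_def delete_edges_def complete_bipartite_def)

lemma pverts_extremal_graph: "pverts (extremal_graph m k) = Inl ` {..<m} \<union> Inr ` {..<m}"
  by (simp add: extremal_graph_def delete_edges_def complete_bipartite_def)

lemma parcs_extremal_graph_sym:
  "(u, v) \<in> parcs (extremal_graph m k) \<Longrightarrow> (v, u) \<in> parcs (extremal_graph m k)"
  by (cases u; cases v) auto

lemma pair_graph_extremal_graph: "pair_graph (extremal_graph m k)"
proof
  have sub: "parcs (extremal_graph m k) \<subseteq> pverts (extremal_graph m k) \<times> pverts (extremal_graph m k)"
    by (auto simp: extremal_graph_def delete_edges_def complete_bipartite_def)
  then show "e \<in> parcs (extremal_graph m k) \<Longrightarrow> fst e \<in> pverts (extremal_graph m k)"
    "e \<in> parcs (extremal_graph m k) \<Longrightarrow> snd e \<in> pverts (extremal_graph m k)" for e by auto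
  show fin: "finite (pverts (extremal_graph m k))" by (simp add: pverts_extremal_graph)
  show "finite (parcs (extremal_graph m k))" using finite_subset[OF sub] fin by simp
  show "e \<in> parcs (extremal_graph m k) \<Longrightarrow> fst e \<noteq> snd e" for e
    by (cases e; cases "fst e"; cases "snd e") auto
  show "symmetric (with_proj (extremal_graph m k))"
    by (auto simp: symmetric_def sym_def intro: parcs_extremal_graph_sym)
qed

text \<open>A monic quadratic negative at \<open>q\<close> has \<open>q\<close> strictly between its
  roots, so the larger root serves. The assumption, multiplied by 4, compares
  \<open>(2 * q - e)\<^sup>2\<close> with the discriminant \<open>D\<close>.\<close>

lemma quadratic_root_gt:
  fixes q e c :: real
  assumes "q\<^sup>2 - e * q + c < 0"
  shows "\<exists>l > q. l\<^sup>2 - e * l + c = 0"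
proof -
  define D where "D = e\<^sup>2 - 4 * c"
  have "(2 * q - e)\<^sup>2 < D"
    using assms by (simp add: D_def power2_eq_square algebra_simps)
  then have D: "D \<ge> 0" "\<bar>2 * q - e\<bar> < sqrt D"
    by (smt (verit) zero_le_power2) (metis \<open>(2 * q - e)\<^sup>2 < D\<close> real_sqrt_abs real_sqrt_less_iff)
  have "((e + sqrt D) / 2)\<^sup>2 - e * ((e + sqrt D) / 2) + c = 0"
    using D(1) by (simp add: D_def power2_eq_square field_simps)
  moreover have "(e + sqrt D) / 2 > q" using D(2) by (auto simp: abs_less_iff field_simps)
  ultimately show ?thesis by blast
qed

lemma sum_split_at:
  fixes c d :: real and p m :: nat
  assumes "p \<le> m"
  shows "(\<Sum>j<m. if p \<le> j then c else d) = (real m - real p) * c + real p * d"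
proof -
  have "(\<Sum>j<m. if p \<le> j then c else d) =
      (\<Sum>j\<in>{..<p}. if p \<le> j then c else d) + (\<Sum>j\<in>{p..<m}. if p \<le> j then c else d)"
    using assms by (subst sum.union_disjoint[symmetric]) (auto intro: arg_cong[where f = "sum _"])
  then show ?thesis using assms by (simp add: of_nat_diff)
qed

text \<open>The eigenfunction is constant on four classes: \<open>b\<close> at \<open>Inl 0\<close>,
  \<open>a\<close> at the other \<open>Inl\<close> vertices, \<open>c\<close> at the
  \<open>k - 1\<close> neighbours of \<open>Inl 0\<close>, \<open>d\<close> at the remaining
  \<open>Inr\<close> vertices. The four eigenvalue equations reduce to one quadratic in
  \<open>l\<close>, the square of \<open>\<theta>\<close>.\<close>

lemma extremal_graph_perron:
  assumes k: "2 \<le> k" "k < m"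
  obtains f \<theta> where "\<And>v. v \<in> pverts (extremal_graph m k) \<Longrightarrow> f v > 0"
    "\<And>v. v \<in> pverts (extremal_graph m k) \<Longrightarrow>
      nbr_sum (parcs (extremal_graph m k)) (pverts (extremal_graph m k)) f v = \<theta> * f v"
    "\<theta> > 0" "\<theta>\<^sup>2 > real (m * (m - 1))"
proof -
  define M K q where "M = real m" and "K = real (k - 1)" and "q = real (m * (m - 1))"
  have q: "q = M * (M - 1)" using k by (simp add: q_def M_def of_nat_diff)
  have MK: "K \<ge> 1" "K + 2 \<le> M" using k by (auto simp: K_def M_def)
  \<comment> \<open>Eliminating \<open>a\<close>, \<open>b\<close>, \<open>c\<close>,
    \<open>d\<close> gives \<open>(l - q) * (l - K) = K\<^sup>2 * (M - 1)\<close>. At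
    \<open>l = q\<close> the left side vanishes, so the quadratic is negative there and its larger
    root exceeds \<open>q\<close>.\<close>
  have "q\<^sup>2 - (q + K) * q + K * (M - 1) * (M - K) = - (K\<^sup>2 * (M - 1))"
    unfolding q by (simp add: power2_eq_square algebra_simps)
  moreover have "K\<^sup>2 * (M - 1) > 0" using MK by simp
  ultimately have "q\<^sup>2 - (q + K) * q + K * (M - 1) * (M - K) < 0" by simp
  then obtain l where l: "l > q" "l\<^sup>2 - (q + K) * l + K * (M - 1) * (M - K) = 0"
    using quadratic_root_gt by blast
  have "q \<ge> 1 * (M - 1)" unfolding q using MK by (intro mult_right_mono) auto
  then have qK: "q > K" using MK by simp
  define \<theta> where "\<theta> = sqrt l"
  have \<theta>: "\<theta> > 0" "\<theta> * \<theta> = l" using l qK MK by (auto simp: \<theta>_def)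
  \<comment> \<open>The equation at \<open>Inl 0\<close> becomes
    \<open>(l - K) * b = K * (M - 1) * a\<close>, which fixes \<open>a\<close> and \<open>b\<close>
    up to scaling; positivity of \<open>a\<close> follows from \<open>l > q\<close> and
    \<open>q > K\<close>. The equations at the \<open>Inr\<close> vertices define \<open>c\<close>
    and \<open>d\<close>, and the quadratic gives the remaining one, \<open>ev_a\<close>.\<close>
  define a b c d where "a = l - K" and "b = K * (M - 1)"
    and "c = ((M - 1) * a + b) / \<theta>" and "d = (M - 1) * a / \<theta>"
  have pos: "a > 0" "b > 0" using l qK MK by (auto simp: a_def b_def)
  then have pos': "c > 0" "d > 0" using MK \<theta> by (auto simp: c_def d_def intro!: divide_pos_pos add_pos_pos)
  have ev_c: "\<theta> * c = (M - 1) * a + b" and ev_d: "\<theta> * d = (M - 1) * a"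
    using \<theta> by (auto simp: c_def d_def)
  have "\<theta> * (\<theta> * b) = \<theta> * (K * c)"
  proof -
    have "\<theta> * (\<theta> * b) = l * b" using \<theta> by (simp add: mult.assoc[symmetric])
    also have "\<dots> = K * (\<theta> * c)" unfolding ev_c by (simp add: a_def b_def algebra_simps)
    finally show ?thesis by (simp add: mult_ac)
  qed
  then have ev_b: "\<theta> * b = K * c" using \<theta> by simp
  have "\<theta> * (\<theta> * a) = \<theta> * (K * c + (M - K) * d)"
  proof -
    have "\<theta> * (\<theta> * a) = l * a" using \<theta> by (simp add: mult.assoc[symmetric])
    also have "\<dots> = K * (\<theta> * c) + (M - K) * (\<theta> * d)"
      unfolding ev_c ev_d using l(2) unfolding a_def b_def q
      by (simp add: power2_eq_square algebra_simps)
    finally show ?thesis by (simp add: algebra_simps)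
  qed
  then have ev_a: "\<theta> * a = K * c + (M - K) * d" using \<theta> by simp
  define f :: "nat + nat \<Rightarrow> real" where
    "f = case_sum (\<lambda>i. if i = 0 then b else a) (\<lambda>j. if m - k < j then c else d)"
  have sum_V: "(\<Sum>u\<in>pverts (extremal_graph m k). h u) = (\<Sum>i<m. h (Inl i)) + (\<Sum>j<m. h (Inr j))"
    for h :: "nat + nat \<Rightarrow> real"
    unfolding pverts_extremal_graph
    by (subst sum.union_disjoint) (auto simp: sum.reindex)
  have nat_K: "real m - real (Suc (m - k)) = K" "real (Suc (m - k)) = M - K"
    using k by (auto simp: K_def M_def of_nat_diff)
  have sum_Y: "(\<Sum>j<m. if m - k < j then c' else d') = K * c' + (M - K) * d'" for c' d' :: real
    using sum_split_at[of "Suc (m - k)" m c' d'] k by (simp add: nat_K Suc_le_eq M_def del: of_nat_Suc)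
  have sum_X: "(\<Sum>i<m. if i = 0 then b' else a') = (M - 1) * a' + b'" for a' b' :: real
  proof -
    have "(\<Sum>i<m. if i = 0 then b' else a') = (\<Sum>i<m. if 1 \<le> i then a' else b')"
      by (intro sum.cong) auto
    then show ?thesis using sum_split_at[of 1 m a' b'] k by (simp add: M_def)
  qed
  show thesis
  proof (rule that[of f \<theta>])
    fix v assume v: "v \<in> pverts (extremal_graph m k)"
    show "f v > 0" using pos pos' by (auto simp: f_def split: sum.split)
    show "nbr_sum (parcs (extremal_graph m k)) (pverts (extremal_graph m k)) f v = \<theta> * f v"
    proof (cases v)
      case (Inl i)
      then have i: "i < m" using v by (auto simp: pverts_extremal_graph)
      have "nbr_sum (parcs (extremal_graph m k)) (pverts (extremal_graph m k)) f v =
          (\<Sum>j<m. if m - k < j then c else if i = 0 then 0 else d)"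
        unfolding nbr_sum_def sum_V using Inl i by (auto simp: f_def intro!: sum.cong)
      then show ?thesis using Inl by (simp add: sum_Y f_def ev_a ev_b)
    next
      case (Inr j)
      then have j: "j < m" using v by (auto simp: pverts_extremal_graph)
      have "nbr_sum (parcs (extremal_graph m k)) (pverts (extremal_graph m k)) f v =
          (\<Sum>i<m. if i = 0 then if m - k < j then b else 0 else a)"
        unfolding nbr_sum_def sum_V using Inr j by (auto simp: f_def intro!: sum.cong)
      then show ?thesis using Inr by (simp add: sum_X f_def ev_c ev_d)
    qed
  next
    show "\<theta> > 0" by (rule \<theta>)
    show "\<theta>\<^sup>2 > real (m * (m - 1))" using l(1) \<theta> by (simp add: power2_eq_square q_def)
  qed
qed

section \<open>Embedding into the extremal graph\<close>

text \<open>Bijections of \<open>D\<close> and of \<open>Y - D\<close> are glued. This provides the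
  labelling that puts chosen vertices onto the centre or the leaves of the deleted star.\<close>

lemma ex_bij_betw_initial_segment:
  assumes "finite Y" "D \<subseteq> Y"
  obtains h where "bij_betw h Y {..<card Y}" "h ` D = {..<card D}"
proof -
  have fD: "finite D" using assms finite_subset by blast
  have le: "card D \<le> card Y" using assms by (rule card_mono)
  obtain h1 where h1: "bij_betw h1 D {..<card D}"
    using finite_same_card_bij[OF fD, of "{..<card D}"] by auto
  obtain h2 where h2: "bij_betw h2 (Y - D) {card D..<card Y}"
    using finite_same_card_bij[of "Y - D" "{card D..<card Y}"] assms fD
    by (auto simp: card_Diff_subset)
  define h where "h y = (if y \<in> D then h1 y else h2 y)" for y
  have b1: "bij_betw h D {..<card D}" using h1 by (simp add: h_def cong: bij_betw_cong)
  have b2: "bij_betw h (Y - D) {card D..<card Y}"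
    using h2 by (subst bij_betw_cong[of _ _ h2]) (auto simp: h_def)
  have "bij_betw h (D \<union> (Y - D)) ({..<card D} \<union> {card D..<card Y})"
    using b1 b2 by (rule bij_betw_combine) auto
  moreover have "D \<union> (Y - D) = Y" "{..<card D} \<union> {card D..<card Y} = {..<card Y}"
    using assms le by auto
  ultimately show ?thesis using that[of h] b1 by (simp add: bij_betw_def)
qed

text \<open>A vertex \<open>x\<close> of degree below \<open>k\<close> has at least
  \<open>m - k + 1\<close> non-neighbours in the other part. Sending \<open>x\<close> to
  \<open>Inl 0\<close> and exactly that many non-neighbours \<open>D\<close> to the leaves of the
  deleted star keeps every arc inside the extremal graph.\<close>

lemma embeds_extremal_graph:
  fixes G :: "'a pair_pre_digraph"
  assumes G: "pair_graph G" and bip: "bipartition G X Y" and card: "card X = m" "card Y = m"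
    and k: "1 \<le> k" "k \<le> m" and x: "x \<in> X" "card (parcs G `` {x}) < k"
  obtains \<phi> where "bij_betw \<phi> (pverts G) (pverts (extremal_graph m k))"
    "\<And>u v. (u, v) \<in> parcs G \<Longrightarrow> (\<phi> u, \<phi> v) \<in> parcs (extremal_graph m k)"
proof -
  interpret pair_graph G by fact
  have V: "X \<union> Y = pverts G" "X \<inter> Y = {}" and arcs: "parcs G \<subseteq> X \<times> Y \<union> Y \<times> X"
    using bip by (auto simp: bipartition_def)
  have fin: "finite X" "finite Y" using pair_finite_verts V(1) by (metis finite_Un)+
  let ?N = "parcs G `` {x}"
  have "?N \<subseteq> Y" using arcs V x by auto
  moreover from this have "finite ?N" using fin finite_subset by blast
  ultimately have "m - k + 1 \<le> card (Y - ?N)"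
    using x k card by (simp add: card_Diff_subset)
  then obtain D where D: "D \<subseteq> Y - ?N" "card D = m - k + 1"
    using obtain_subset_with_card_n by metis
  obtain hX where hX: "bij_betw hX X {..<m}" "hX ` {x} = {..<card {x}}"
    using ex_bij_betw_initial_segment[OF fin(1), of "{x}"] x card by auto
  obtain hY where hY: "bij_betw hY Y {..<m}" "hY ` D = {..<m - k + 1}"
    using ex_bij_betw_initial_segment[OF fin(2), of D] D card by auto
  have hX0: "hX u = 0 \<longleftrightarrow> u = x" if "u \<in> X" for u
  proof -
    have "hX x = 0" using hX(2) by auto
    then show ?thesis using hX(1) that x by (metis bij_betw_def inj_onD)
  qed
  have hYD: "m - k < hY y" if "y \<in> Y" "y \<notin> D" for y
  proof (rule ccontr)
    assume "\<not> ?thesis"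
    then have "hY y \<in> hY ` D" using hY(2) by simp
    then show False using hY(1) D that by (auto simp: bij_betw_def inj_on_def)
  qed
  define \<phi> where "\<phi> v = (if v \<in> X then Inl (hX v) else Inr (hY v))" for v
  have arc: "(Inl (hX u), Inr (hY v)) \<in> parcs (extremal_graph m k)"
    if "(u, v) \<in> parcs G" "u \<in> X" "v \<in> Y" for u v
  proof -
    have "v \<notin> D" if "u = x" using that D \<open>(u, v) \<in> parcs G\<close> by auto
    then show ?thesis using that hX0[of u] hYD[of v] hX(1) hY(1) by (auto simp: bij_betw_def)
  qed
  show thesis
  proof (rule that[of \<phi>])
    have "bij_betw \<phi> X (Inl ` {..<m})"
      using hX(1) by (auto simp: \<phi>_def bij_betw_def inj_on_def)
    moreover have "bij_betw \<phi> Y (Inr ` {..<m})"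
    proof -
      have "\<phi> v = Inr (hY v)" if "v \<in> Y" for v using that V by (auto simp: \<phi>_def)
      then show ?thesis using hY(1) by (auto simp: bij_betw_def inj_on_def image_iff)
    qed
    ultimately show "bij_betw \<phi> (pverts G) (pverts (extremal_graph m k))"
      unfolding V(1)[symmetric] pverts_extremal_graph by (rule bij_betw_combine) auto
  next
    fix u v assume uv: "(u, v) \<in> parcs G"
    then have vu: "(v, u) \<in> parcs G" using arcs_symmetric by blast
    consider "u \<in> X" "v \<in> Y" | "u \<in> Y" "v \<in> X" using uv arcs by auto
    then show "(\<phi> u, \<phi> v) \<in> parcs (extremal_graph m k)"
    proof cases
      case 1
      then show ?thesis using arc[OF uv] V by (auto simp: \<phi>_def)
    next
      case 2
      then show ?thesis using parcs_extremal_graph_sym[OF arc[OF vu]] V by (auto simp: \<phi>_def)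
    qed
  qed
qed

section \<open>Connectedness and the equality case\<close>

lemma connected_closed_set_eq:
  assumes conn: "Digraph_Component.connected (with_proj G)" and "pair_graph G"
    and S: "S \<subseteq> pverts G" "S \<noteq> {}"
    and closed: "\<And>u v. u \<in> S \<Longrightarrow> v \<in> pverts G \<Longrightarrow> (u, v) \<in> parcs G \<Longrightarrow> v \<in> S"
  shows "S = pverts G"
proof
  interpret pair_graph G by fact
  \<comment> \<open>Connectedness is strong connectedness of the symmetric closure, which adds no
    arcs to a symmetric graph.\<close>
  let ?H = "mk_symmetric (with_proj G)"
  have parcs: "parcs ?H = parcs G"
    using arcs_symmetric by (force simp: mk_symmetric_def)
  have pverts: "pverts ?H = pverts G" by (simp add: mk_symmetric_def)
  obtain s where s: "s \<in> S" using S by auto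
  show "pverts G \<subseteq> S"
  proof
    fix v assume "v \<in> pverts G"
    then have "(s, v) \<in> rtrancl_on (pverts G) (parcs G)"
      using conn s S parcs pverts
      by (auto simp: Digraph_Component.connected_def strongly_connected_def reachable_def)
    then show "v \<in> S"
      by (induction rule: rtrancl_on_induct) (use s closed in auto)
  qed
qed (fact S)

lemma spectral_extremal_iso:
  fixes G :: "'a pair_pre_digraph"
  assumes G: "pair_graph G" and conn: "Digraph_Component.connected (with_proj G)"
    and bij: "bij_betw \<phi> (pverts G) (pverts (extremal_graph m k))"
    and arcs: "\<And>u v. (u, v) \<in> parcs G \<Longrightarrow> (\<phi> u, \<phi> v) \<in> parcs (extremal_graph m k)"
    and fpos: "\<And>v. v \<in> pverts (extremal_graph m k) \<Longrightarrow> f v > 0"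
    and ev: "\<And>v. v \<in> pverts (extremal_graph m k) \<Longrightarrow>
      nbr_sum (parcs (extremal_graph m k)) (pverts (extremal_graph m k)) f v = \<theta> * f v"
    and \<theta>: "\<theta> > 0" "\<theta> \<le> graph_spectral_radius G" and ne: "pverts G \<noteq> {}"
  shows "digraph_iso (with_proj G) (with_proj (extremal_graph m k))"
proof -
  interpret pair_graph G by fact
  interpret E: pair_graph "extremal_graph m k" by (rule pair_graph_extremal_graph)
  let ?V = "pverts G" and ?EV = "pverts (extremal_graph m k)" and ?EA = "parcs (extremal_graph m k)"
  \<comment> \<open>The extremal graph pulled back to the vertices of \<open>G\<close>. There
    \<open>f \<circ> \<phi>\<close> is a positive eigenfunction, so the comparison shows that
    \<open>G\<close> lacks no arc of \<open>B\<close> and \<open>\<phi>\<close> is an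
    isomorphism.\<close>
  define B where "B = {(u, v). u \<in> ?V \<and> v \<in> ?V \<and> (\<phi> u, \<phi> v) \<in> ?EA}"
  have \<phi>V: "\<phi> v \<in> ?EV" if "v \<in> ?V" for v using bij that by (auto simp: bij_betw_def)
  obtain g where g: "\<exists>v\<in>?V. g v \<noteq> 0"
    "\<And>v. v \<in> ?V \<Longrightarrow> nbr_sum (parcs G) ?V g v = graph_spectral_radius G * g v"
    using eigenvalue_graph_spectral_radius(1)[OF G ne] by blast
  have "B \<inter> ?V \<times> ?V \<subseteq> parcs G"
  proof (rule perron_comparison[where f = "f \<circ> \<phi>" and g = g and \<theta> = \<theta> and \<rho> = "graph_spectral_radius G"])
    show "parcs G \<subseteq> B" using arcs wellformed' by (auto simp: B_def)
    show "(u, v) \<in> parcs G \<Longrightarrow> (v, u) \<in> parcs G" for u v using arcs_symmetric by blast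
    show "(u, v) \<in> B \<Longrightarrow> (v, u) \<in> B" for u v by (auto simp: B_def parcs_extremal_graph_sym)
    show "nbr_sum B ?V (f \<circ> \<phi>) v = \<theta> * (f \<circ> \<phi>) v" if v: "v \<in> ?V" for v
    proof -
      have "nbr_sum B ?V (f \<circ> \<phi>) v = (\<Sum>u\<in>?V. if (\<phi> v, \<phi> u) \<in> ?EA then f (\<phi> u) else 0)"
        unfolding nbr_sum_def using v by (intro sum.cong) (auto simp: B_def)
      also have "\<dots> = nbr_sum ?EA ?EV f (\<phi> v)"
        unfolding nbr_sum_def
        using sum.reindex_bij_betw[OF bij, of "\<lambda>u. if (\<phi> v, u) \<in> ?EA then f u else 0"] .
      finally show ?thesis using ev[OF \<phi>V[OF v]] by simp
    qed
    show "S = ?V" if "S \<subseteq> ?V" "S \<noteq> {}"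
      "\<And>u v. u \<in> S \<Longrightarrow> v \<in> ?V \<Longrightarrow> (u, v) \<in> parcs G \<Longrightarrow> v \<in> S" for S
      using that(3) by (rule connected_closed_set_eq[OF conn G that(1,2)])
  qed (use pair_finite_verts fpos \<phi>V g \<theta> in auto)
  then have iff: "(u, v) \<in> parcs G" if "u \<in> ?V" "v \<in> ?V" "(\<phi> u, \<phi> v) \<in> ?EA" for u v
    using that by (auto simp: B_def)
  define h where "h = \<lparr>iso_verts = \<phi>, iso_arcs = map_prod \<phi> \<phi>, iso_head = snd, iso_tail = fst\<rparr>"
  have img: "map_prod \<phi> \<phi> ` parcs G = ?EA"
  proof
    show "?EA \<subseteq> map_prod \<phi> \<phi> ` parcs G"
    proof
      fix e assume e: "e \<in> ?EA"
      obtain a b where ab: "e = (a, b)" by force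
      then have "a \<in> ?EV" "b \<in> ?EV" using e E.wellformed' by auto
      then obtain u v where "u \<in> ?V" "v \<in> ?V" "a = \<phi> u" "b = \<phi> v"
        using bij by (metis bij_betw_def imageE)
      then show "e \<in> map_prod \<phi> \<phi> ` parcs G" using iff[of u v] e ab by force
    qed
  qed (use arcs in auto)
  have inj: "inj_on \<phi> ?V" and im: "\<phi> ` ?V = ?EV" using bij by (auto simp: bij_betw_def)
  have "inj_on (map_prod \<phi> \<phi>) (parcs G)"
    by (rule inj_on_subset[OF map_prod_inj_on[OF inj inj]]) (use wellformed' in auto)
  then have "pre_digraph.digraph_isomorphism (with_proj G) h"
    using inj wf_digraph by (auto simp: pre_digraph.digraph_isomorphism_def h_def)
  moreover have "with_proj (extremal_graph m k) = app_iso h (with_proj G)"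
    using img im by (simp add: app_iso_def with_proj_def h_def)
  ultimately show ?thesis unfolding digraph_iso_def by blast
qed

section \<open>From regular relations to factors, and the conclusion\<close>

lemma k_factor_of_regular_relation:
  fixes G :: "'a pair_pre_digraph"
  assumes G: "pair_graph G" and bip: "bipartition G X Y"
    and F: "F \<subseteq> parcs G \<inter> X \<times> Y"
    and deg: "\<And>x. x \<in> X \<Longrightarrow> card (F `` {x}) = k" "\<And>y. y \<in> Y \<Longrightarrow> card (F\<inverse> `` {y}) = k"
  shows "k_factor k \<lparr>pverts = pverts G, parcs = F \<union> F\<inverse>\<rparr> G"
proof -
  let ?H = "\<lparr>pverts = pverts G, parcs = F \<union> F\<inverse>\<rparr>"
  interpret pair_graph G by fact
  have V: "X \<union> Y = pverts G" "X \<inter> Y = {}" using bip by (auto simp: bipartition_def)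
  have sub: "F \<union> F\<inverse> \<subseteq> parcs G" using F arcs_symmetric by blast
  have H: "pair_graph ?H"
  proof
    show "finite (parcs ?H)" using finite_subset[OF sub] pair_finite_arcs by simp
    show "symmetric (with_proj ?H)" by (auto simp: symmetric_def sym_def)
  qed (use sub wellformed' pair_finite_verts pair_no_loops in auto)
  then interpret H: pair_graph ?H .
  have "spanning (with_proj ?H) (with_proj G)"
    using sub H.wf_digraph wf_digraph by (simp add: spanning_def subgraph_def compatible_def)
  moreover have "out_degree (with_proj ?H) v = k" if "v \<in> pverts G" for v
  proof -
    have "out_arcs (with_proj ?H) v = Pair v ` ((F \<union> F\<inverse>) `` {v})" by (auto simp: out_arcs_def)
    then have "out_degree (with_proj ?H) v = card ((F \<union> F\<inverse>) `` {v})"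
      by (simp add: out_degree_def card_image inj_on_def)
    also have "\<dots> = k"
    \<comment> \<open>\<open>F\<close> leads only from \<open>X\<close> to \<open>Y\<close>, so at
      each vertex just one of \<open>F\<close> and \<open>F\<inverse>\<close> contributes
      arcs.\<close>
    proof (cases "v \<in> X")
      case True
      then have "(F \<union> F\<inverse>) `` {v} = F `` {v}" using F V by auto
      then show ?thesis using deg True by simp
    next
      case False
      then have "(F \<union> F\<inverse>) `` {v} = F\<inverse> `` {v}" "v \<in> Y" using F V that by auto
      then show ?thesis using deg by simp
    qed
    finally show ?thesis .
  qed
  ultimately show ?thesis using H by (simp add: k_factor_def)
qed

theorem theorem1p3:
  fixes n k :: nat and G :: "'a pair_pre_digraph"
  assumes "even n" and "n > 0"
    and "2 \<le> k" and "k \<le> n div 2 - 1"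
    and "pair_graph G"
    and "Digraph_Component.connected (with_proj G)"
    and "balanced_bipartite G"
    and "card (pverts G) = n"
    and "graph_spectral_radius G \<ge> graph_spectral_radius (extremal_graph (n div 2) k)"
  shows "(\<exists>H. k_factor k H G) \<or>
         digraph_iso (with_proj G) (with_proj (extremal_graph (n div 2) k))"
proof -
  interpret pair_graph G by fact
  define m where "m = n div 2"
  have k: "2 \<le> k" "k < m" using assms(3,4) by (auto simp: m_def)
  obtain X Y where bip: "bipartition G X Y" and XY: "card X = card Y"
    using assms(7) by (auto simp: balanced_bipartite_def)
  have V: "X \<union> Y = pverts G" "X \<inter> Y = {}" and arcs: "parcs G \<subseteq> X \<times> Y \<union> Y \<times> X"
    using bip by (auto simp: bipartition_def)
  have fin: "finite X" "finite Y" using pair_finite_verts V(1) by (metis finite_Un)+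
  have "card X + card Y = n" using card_Un_disjoint[OF fin V(2)] V(1) assms(8) by simp
  then have card: "card X = m" "card Y = m" using XY by (auto simp: m_def)
  have sym: "(u, v) \<in> parcs G \<Longrightarrow> (v, u) \<in> parcs G" for u v using arcs_symmetric by blast
  have ne: "pverts G \<noteq> {}" using assms(2,8) by auto
  obtain f \<theta> where f: "\<And>v. v \<in> pverts (extremal_graph m k) \<Longrightarrow> f v > 0"
    "\<And>v. v \<in> pverts (extremal_graph m k) \<Longrightarrow>
      nbr_sum (parcs (extremal_graph m k)) (pverts (extremal_graph m k)) f v = \<theta> * f v"
    and \<theta>: "\<theta> > 0" "\<theta>\<^sup>2 > real (m * (m - 1))"
    using extremal_graph_perron[OF k] by metis
  have "Inl 0 \<in> pverts (extremal_graph m k)" using k by (auto simp: pverts_extremal_graph)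
  then have "\<theta> \<le> graph_spectral_radius (extremal_graph m k)"
    using f by (intro eigenvalue_graph_spectral_radius(2)[OF pair_graph_extremal_graph, of m k f])
      (force intro!: bexI[of _ "Inl 0"])+
  then have \<theta>_le: "\<theta> \<le> graph_spectral_radius G" using assms(9) by (simp add: m_def)
  define E where "E = parcs G \<inter> X \<times> Y"
  have E_X: "E `` {x} = parcs G `` {x}" if "x \<in> X" for x using that arcs V by (auto simp: E_def)
  have E_Y: "E\<inverse> `` {y} = parcs G `` {y}" if "y \<in> Y" for y
    using that arcs V sym by (auto simp: E_def)
  show ?thesis
  \<comment> \<open>A vertex of degree below \<open>k\<close> places \<open>G\<close> inside the
    extremal graph, leading to the isomorphism; otherwise density and the degree bounds yield the
    factor.\<close>
  proof (cases "\<exists>v\<in>pverts G. card (parcs G `` {v}) < k")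
    case True
    then obtain v where v: "v \<in> X \<union> Y" "card (parcs G `` {v}) < k" using V by auto
    have bip': "bipartition G Y X" using bip by (auto simp: bipartition_def)
    have k': "1 \<le> k" "k \<le> m" using k by auto
    obtain \<phi> where \<phi>: "bij_betw \<phi> (pverts G) (pverts (extremal_graph m k))"
      "\<And>u v. (u, v) \<in> parcs G \<Longrightarrow> (\<phi> u, \<phi> v) \<in> parcs (extremal_graph m k)"
      \<comment> \<open>The vertex may lie in either part, so the embedding is also taken with the
        parts exchanged.\<close>
      using v(1) embeds_extremal_graph[OF assms(5) bip card k' _ v(2)]
        embeds_extremal_graph[OF assms(5) bip' card(2,1) k' _ v(2)] by (metis UnE)
    then show ?thesis
      using spectral_extremal_iso[OF assms(5,6) \<phi> f \<theta>(1) \<theta>_le ne] by (simp add: m_def)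
  next
    case False
    obtain g where g: "\<exists>v\<in>pverts G. g v \<noteq> 0"
      "\<And>v. v \<in> pverts G \<Longrightarrow> nbr_sum (parcs G) (pverts G) g v = graph_spectral_radius G * g v"
      using eigenvalue_graph_spectral_radius(1)[OF assms(5) ne] by blast
    \<comment> \<open>Squaring preserves the comparison of \<open>\<theta>\<close> with the spectral
      radius because \<open>\<theta>\<close> is positive; hence \<open>m * (m - 1)\<close> lies
      below the number of edges.\<close>
    have "(graph_spectral_radius G)\<^sup>2 \<le> card E"
      unfolding E_def using g bipartite_eigenvalue_bound[OF fin V(2) arcs sym] V(1) by metis
    moreover have "\<theta>\<^sup>2 \<le> (graph_spectral_radius G)\<^sup>2"
      using \<theta> \<theta>_le by (intro power_mono) auto
    ultimately have "real (m * (m - 1)) < real (card E)" using \<theta>(2) by linarith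
    then have dense: "m * (m - 1) < card E" by (simp only: of_nat_less_iff)
    obtain F where F: "F \<subseteq> E" "\<And>x. x \<in> X \<Longrightarrow> card (F `` {x}) = k"
      "\<And>y. y \<in> Y \<Longrightarrow> card (F\<inverse> `` {y}) = k"
    proof (rule dense_bipartite_regular_subgraph[OF fin card _ k(2) dense])
      show "E \<subseteq> X \<times> Y" by (auto simp: E_def)
      show "k \<le> card (E `` {x})" if "x \<in> X" for x
        using False V(1) that by (auto simp: E_X not_less)
      show "k \<le> card (E\<inverse> `` {y})" if "y \<in> Y" for y
        using False V(1) that by (auto simp: E_Y not_less)
    qed (use that in blast)
    then show ?thesis
      using k_factor_of_regular_relation[OF assms(5) bip, of F k] by (auto simp: E_def)
  qed
qed

end
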